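(* Let $|q|<1$ and $x\in\mathbb{C}$. Then \[ \sum_{n\geq 0} \frac{q^{n^2+n}(-1;q^2)_n \prod_{i=1}^n(1+2xq^{2i-1}+q^{4i-2})}{(q^2;q^2)_{2n}} =\frac{(-q^2;q^2)_\infty}{(q^2;q^2)_{\infty}}\sum_{n\geq 0}\frac{(-1;q^2)_n q^{2n^2+n}}{(-q^2;q^2)_n} \big(V_n(x)+V_{n-1}(x)\big). \]
   Context: $(a;q)_n=\prod_{k=0}^{n-1}(1-aq^k)$, $(a;q)_\infty=\prod_{k\ge0}(1-aq^k)$. $V_n(x)$ is the Chebyshev polynomial of the third kind: $V_0=1$, $V_1=2x-1$, $V_n=2xV_{n-1}-V_{n-2}$ ($n>1$), and $V_n=0$ for $n<0$. *)

theory Defs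
  imports "HOL-Analysis.Analysis"
begin

definition qpoch :: "complex \<Rightarrow> complex \<Rightarrow> nat \<Rightarrow> complex" where
  "qpoch a q n = (\<Prod>k<n. 1 - a * q ^ k)"

definition qpoch_inf :: "complex \<Rightarrow> complex \<Rightarrow> complex" where
  "qpoch_inf a q = (\<Prod>k. 1 - a * q ^ k)"

text \<open>Values of the Chebyshev polynomials of the third kind, with an integer index so that
  the convention for negative indices is literal.\<close>

function chebyshev_V :: "int \<Rightarrow> complex \<Rightarrow> complex" where
  "chebyshev_V n x =
    (if n < 0 then 0
     else if n = 0 then 1
     else if n = 1 then 2 * x - 1
     else 2 * x * chebyshev_V (n - 1) x - chebyshev_V (n - 2) x)"
  by auto
termination
  by (relation "Wellfounded.measure (\<lambda>(n, x). nat n)") auto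

declare chebyshev_V.simps [simp del]

end

theory Submission
  imports Defs
begin

text \<open>
  The sequence \<open>V\<^sub>n + V\<^sub>n\<^sub>-\<^sub>1\<close> satisfies the three-term recurrence of \<open>z\<^sup>n + z\<^sup>-\<^sup>n\<close> with
  \<open>2x = z + 1/z\<close>, so the finite Jacobi triple product expands the left-hand product
  in the \<open>V\<^sub>k + V\<^sub>k\<^sub>-\<^sub>1\<close>, with coefficients \<open>q\<^bsup>k*k\<^esup> / ((Q;Q)\<^sub>n\<^sub>-\<^sub>k (Q;Q)\<^sub>n\<^sub>+\<^sub>k)\<close> after division by
  \<open>(Q;Q)\<^sub>2\<^sub>n\<close>, where \<open>Q = q\<^sup>2\<close>. After interchanging the sums, the inner sum over \<open>n\<close> is the limit
  \<open>a \<rightarrow> \<infinity>\<close> of the q-Gauss sum \<open>\<^sub>2\<phi>\<^sub>1(a, b; bd; d/a)\<close>, taken at \<open>b = - Q\<^sup>k\<close> and \<open>d = - Q\<^bsup>k+1\<^esup>\<close>.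
  This sum \<open>S(d)\<close> is evaluated by iterating \<open>(1 - bd) S(d) = (1 - d) S(dQ)\<close>, whose termwise
  difference telescopes. Tannery's theorem justifies both the limit and the interchange.
\<close>

section \<open>Shifted factorials\<close>

lemma qpoch_0 [simp]: "qpoch a q 0 = 1"
  by (simp add: qpoch_def)

lemma qpoch_Suc: "qpoch a q (Suc n) = qpoch a q n * (1 - a * q ^ n)"
  by (simp add: qpoch_def)

lemma qpoch_add: "qpoch a q (m + n) = qpoch a q m * qpoch (a * q ^ m) q n"
  by (induction n) (simp_all add: qpoch_Suc power_add algebra_simps)

lemma qpoch_Suc_left: "qpoch a q (Suc n) = (1 - a) * qpoch (a * q) q n"
  using qpoch_add[of a q 1 n] by (simp add: qpoch_Suc)

lemma qpoch_nonzero: "(\<And>k. a * q ^ k \<noteq> 1) \<Longrightarrow> qpoch a q n \<noteq> 0"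
  by (auto simp: qpoch_def)

lemma mult_power_neq_1:
  fixes a q :: complex
  assumes "norm q < 1" "norm a < 1"
  shows "a * q ^ k \<noteq> 1"
proof
  assume eq: "a * q ^ k = 1"
  have "norm a * norm q ^ k \<le> norm a * 1"
    using assms by (intro mult_left_mono power_le_one) auto
  moreover have "norm (a * q ^ k) = 1"
    using eq by simp
  ultimately show False
    using assms by (simp add: norm_mult norm_power)
qed

lemma convergent_prod_qpoch:
  fixes a q :: complex
  assumes "norm q < 1"
  shows "convergent_prod (\<lambda>k. 1 - a * q ^ k)"
proof -
  have "summable (\<lambda>k. norm a * norm q ^ k)"
    using assms by (intro summable_mult summable_geometric) auto
  then show ?thesis
    by (intro abs_convergent_prod_imp_convergent_prod summable_imp_abs_convergent_prod)
       (simp add: norm_mult norm_power)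
qed

lemma qpoch_LIMSEQ:
  assumes "norm q < 1"
  shows "qpoch a q \<longlonglongrightarrow> qpoch_inf a q"
proof -
  have "(\<lambda>n. \<Prod>k\<le>n. 1 - a * q ^ k) \<longlonglongrightarrow> qpoch_inf a q"
    unfolding qpoch_inf_def by (intro convergent_prod_LIMSEQ convergent_prod_qpoch assms)
  then have "(\<lambda>n. qpoch a q (Suc n)) \<longlonglongrightarrow> qpoch_inf a q"
    by (simp add: qpoch_def lessThan_Suc_atMost)
  then show ?thesis
    by (simp only: filterlim_sequentially_Suc)
qed

lemma qpoch_inf_nonzero:
  assumes "norm q < 1" "\<And>k. a * q ^ k \<noteq> 1"
  shows "qpoch_inf a q \<noteq> 0"
  unfolding qpoch_inf_def
  using assms by (intro prodinf_nonzero convergent_prod_qpoch) auto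

lemma qpoch_inf_split:
  assumes "norm q < 1"
  shows "qpoch_inf a q = qpoch a q n * qpoch_inf (a * q ^ n) q"
proof (rule LIMSEQ_unique)
  show "(\<lambda>m. qpoch a q (n + m)) \<longlonglongrightarrow> qpoch_inf a q"
    using LIMSEQ_ignore_initial_segment[OF qpoch_LIMSEQ[OF assms, of a], of n]
    by (simp add: add.commute)
  show "(\<lambda>m. qpoch a q (n + m)) \<longlonglongrightarrow> qpoch a q n * qpoch_inf (a * q ^ n) q"
    unfolding qpoch_add by (intro tendsto_intros qpoch_LIMSEQ assms)
qed

lemma qpoch_bounded:
  assumes "norm q < 1"
  obtains C where "C > 0" "\<And>n. norm (qpoch a q n) \<le> C"
  using convergent_imp_Bseq[OF convergentI[OF qpoch_LIMSEQ[OF assms, of a]]]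
  by (auto simp: Bseq_def)

text \<open>The limit of the shifted factorials is nonzero, so their inverses converge too. This
  bounds denominators uniformly in \<open>n\<close>, as the majorants below require.\<close>

lemma inverse_qpoch_bounded:
  assumes "norm q < 1" "\<And>k. a * q ^ k \<noteq> 1"
  obtains C where "C > 0" "\<And>n. norm (inverse (qpoch a q n)) \<le> C"
  using convergent_imp_Bseq[OF convergentI[OF tendsto_inverse[OF qpoch_LIMSEQ[OF assms(1), of a]
        qpoch_inf_nonzero[OF assms]]]]
  by (auto simp: Bseq_def)

section \<open>Triangular exponents and a majorant series\<close>

lemma Suc_choose_two: "Suc n choose 2 = (n choose 2) + n"
  by (simp add: numeral_2_eq_2)

lemma two_choose_two: "2 * (n choose 2) + n = n\<^sup>2"
  by (induction n) (simp_all add: Suc_choose_two power2_eq_square)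

text \<open>Consecutive terms have ratio \<open>R * r ^ n\<close>, which tends to 0 however large
  \<open>R\<close> is. Both applications of Tannery's theorem use this majorant, with an
  \<open>R\<close> that may exceed 1.\<close>

lemma summable_power_choose_two:
  fixes R r :: real
  assumes "0 \<le> R" "0 \<le> r" "r < 1"
  shows "summable (\<lambda>n. R ^ n * r ^ (n choose 2))"
proof -
  have "(\<lambda>n. R * r ^ n) \<longlonglongrightarrow> R * 0"
    using assms by (intro tendsto_intros LIMSEQ_realpow_zero)
  then have "eventually (\<lambda>n. R * r ^ n < 1/2) sequentially"
    by (intro order_tendstoD(2)) auto
  then obtain N where N: "\<And>n. n \<ge> N \<Longrightarrow> R * r ^ n < 1/2"
    by (auto simp: eventually_at_top_linorder)
  show ?thesis
  proof (rule summable_ratio_test)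
    show "1/2 < (1::real)" by simp
    fix n assume "N \<le> n"
    then have "(R * r ^ n) * (R ^ n * r ^ (n choose 2)) \<le> 1/2 * (R ^ n * r ^ (n choose 2))"
      using N[of n] assms by (intro mult_right_mono) auto
    then show "norm (R ^ Suc n * r ^ (Suc n choose 2)) \<le> 1/2 * norm (R ^ n * r ^ (n choose 2))"
      using assms by (simp add: Suc_choose_two power_add abs_mult mult_ac)
  qed
qed

section \<open>The limiting case of the q-Gauss sum\<close>

text \<open>As \<open>a\<close> tends to infinity, \<open>(a;q)_m / a^m\<close> tends to
  \<open>(-1)^m q^(m choose 2)\<close>, which explains the numerator. Writing the lower parameter as
  \<open>b * d\<close> makes the shift from \<open>d\<close> to \<open>d * q\<close> act on it and
  on the argument at once.\<close>

definition gauss_term :: "complex \<Rightarrow> complex \<Rightarrow> complex \<Rightarrow> nat \<Rightarrow> complex" where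
  "gauss_term q b d m =
     qpoch b q m * (- d) ^ m * q ^ (m choose 2) / (qpoch q q m * qpoch (b * d) q m)"

lemma gauss_term_0 [simp]: "gauss_term q b d 0 = 1"
  by (simp add: gauss_term_def numeral_2_eq_2)

text \<open>One \<open>K\<close> serves all shifts \<open>N\<close>: the shifted lower factorial is
  the quotient of \<open>qpoch (b * d) q (N + m)\<close> by \<open>qpoch (b * d) q N\<close>, so
  bounds for the unshifted parameter suffice.\<close>

lemma gauss_term_bound:
  assumes q: "norm q < 1" and bd: "\<And>k. b * d * q ^ k \<noteq> 1"
  obtains K where "\<And>N m. norm (gauss_term q b (d * q ^ N) m)
                     \<le> K * (norm (d * q ^ N) ^ m * norm q ^ (m choose 2))"
proof -
  obtain B where B: "B > 0" "\<And>n. norm (qpoch b q n) \<le> B"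
    using qpoch_bounded[OF q] by metis
  obtain D where D: "D > 0" "\<And>n. norm (qpoch (b * d) q n) \<le> D"
    using qpoch_bounded[OF q] by metis
  obtain E where E: "E > 0" "\<And>n. norm (inverse (qpoch (b * d) q n)) \<le> E"
    using inverse_qpoch_bounded[OF q bd] by metis
  obtain F where F: "F > 0" "\<And>n. norm (inverse (qpoch q q n)) \<le> F"
    using inverse_qpoch_bounded[OF q mult_power_neq_1[OF q q]] by metis
  have "norm (gauss_term q b (d * q ^ N) m)
          \<le> (B * F * (D * E)) * (norm (d * q ^ N) ^ m * norm q ^ (m choose 2))" for N m
  proof -
    have "qpoch (b * d) q N \<noteq> 0"
      by (intro qpoch_nonzero bd)
    then have "inverse (qpoch (b * (d * q ^ N)) q m)
        = qpoch (b * d) q N * inverse (qpoch (b * d) q (N + m))"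
      by (simp add: qpoch_add mult.assoc field_simps)
    then have eq: "gauss_term q b (d * q ^ N) m
        = (qpoch b q m * inverse (qpoch q q m) *
           (qpoch (b * d) q N * inverse (qpoch (b * d) q (N + m)))) *
          ((- (d * q ^ N)) ^ m * q ^ (m choose 2))"
      by (simp add: gauss_term_def divide_inverse)
    show ?thesis
      unfolding eq norm_mult
      using B D E F
      by (intro mult_mono mult_nonneg_nonneg)
         (auto simp: norm_mult norm_power power_mult_distrib less_imp_le)
  qed
  then show thesis by (rule that)
qed

lemma summable_gauss_term:
  assumes q: "norm q < 1" and bd: "\<And>k. b * d * q ^ k \<noteq> 1"
  shows "summable (gauss_term q b d)"
proof -
  obtain K where K: "\<And>N m. norm (gauss_term q b (d * q ^ N) m)
                     \<le> K * (norm (d * q ^ N) ^ m * norm q ^ (m choose 2))"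
    using gauss_term_bound[OF q bd] by metis
  show ?thesis
  proof (rule summable_comparison_test')
    show "summable (\<lambda>m. K * (norm d ^ m * norm q ^ (m choose 2)))"
      using q by (intro summable_mult summable_power_choose_two) auto
    show "norm (gauss_term q b d m) \<le> K * (norm d ^ m * norm q ^ (m choose 2))" if "m \<ge> 0" for m
      using K[of 0 m] by simp
  qed
qed

lemma gauss_term_Suc:
  "gauss_term q b d (Suc m) = gauss_term q b d m *
     (- (d * q ^ m * (1 - b * q ^ m)) / ((1 - q ^ Suc m) * (1 - b * d * q ^ m)))"
  by (simp add: gauss_term_def qpoch_Suc Suc_choose_two power_add mult_ac)

lemma gauss_term_shift:
  assumes bd: "\<And>k. b * d * q ^ k \<noteq> 1"
  shows "gauss_term q b (d * q) m = gauss_term q b d m * (q ^ m * (1 - b * d) / (1 - b * d * q ^ m))"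
proof -
  \<comment> \<open>Both sides are \<open>qpoch (b * d) q (Suc m)\<close>, with the last or the
    first factor split off.\<close>
  have "qpoch (b * d) q m * (1 - b * d * q ^ m) = (1 - b * d) * qpoch (b * (d * q)) q m"
    using qpoch_Suc[of "b * d" q m] qpoch_Suc_left[of "b * d" q m] by (simp add: mult.assoc)
  moreover have "b * (d * q) * q ^ k \<noteq> 1" for k
    using bd[of "Suc k"] by (simp add: mult_ac)
  then have "qpoch (b * (d * q)) q m \<noteq> 0"
    by (rule qpoch_nonzero)
  moreover have "qpoch (b * d) q m \<noteq> 0" "1 - b * d * q ^ m \<noteq> 0" "1 - b * d \<noteq> 0"
    using qpoch_nonzero[OF bd] bd[of m] bd[of 0] by auto
  ultimately have "inverse (qpoch (b * (d * q)) q m)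
      = (1 - b * d) / (1 - b * d * q ^ m) * inverse (qpoch (b * d) q m)"
    by (simp add: nonzero_eq_divide_eq inverse_eq_divide divide_simps mult_ac)
  moreover have "(- (d * q)) ^ m = (- d) ^ m * q ^ m"
    by (metis minus_mult_left power_mult_distrib)
  ultimately show ?thesis
    unfolding gauss_term_def divide_inverse inverse_mult_distrib by simp
qed

text \<open>The antidifference is \<open>(1 - q ^ m) * gauss_term q b d m\<close>: it vanishes at
  \<open>m = 0\<close>, and its factor \<open>1 - q ^ Suc m\<close> at the next index cancels the
  new denominator factor from \<open>qpoch q q\<close>.\<close>

lemma gauss_term_telescope:
  assumes q: "norm q < 1" and bd: "\<And>k. b * d * q ^ k \<noteq> 1"
  shows "(1 - b * d) * gauss_term q b d m - (1 - d) * gauss_term q b (d * q) m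
       = (1 - b * d) * ((1 - q ^ m) * gauss_term q b d m - (1 - q ^ Suc m) * gauss_term q b d (Suc m))"
proof -
  have nz: "1 - b * d * q ^ m \<noteq> 0" "1 - q ^ Suc m \<noteq> 0"
    using bd[of m] mult_power_neq_1[OF q q, of m] by auto
  have cancel: "s * (t * (- e / (s * w))) = - (t * e / w)" if "s \<noteq> 0" for s t e w :: complex
    using that by simp
  have t: "(1 - q ^ Suc m) * gauss_term q b d (Suc m)
      = - (gauss_term q b d m * (d * q ^ m * (1 - b * q ^ m)) / (1 - b * d * q ^ m))"
    unfolding gauss_term_Suc by (rule cancel) (rule nz)
  \<comment> \<open>Everything involved is a polynomial multiple of \<open>r\<close>, so only a
    polynomial identity remains.\<close>
  define r where "r = gauss_term q b d m / (1 - b * d * q ^ m)"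
  have t0: "gauss_term q b d m = r * (1 - b * d * q ^ m)"
    using nz(1) by (simp add: r_def)
  have t1: "(1 - q ^ Suc m) * gauss_term q b d (Suc m) = - (r * (d * q ^ m * (1 - b * q ^ m)))"
    unfolding t r_def by simp
  have t2: "gauss_term q b (d * q) m = r * q ^ m * (1 - b * d)"
    unfolding gauss_term_shift[OF bd] r_def by simp
  show ?thesis
    unfolding t1 t2 unfolding t0 by algebra
qed

lemma suminf_gauss_term_shift:
  assumes q: "norm q < 1" and bd: "\<And>k. b * d * q ^ k \<noteq> 1"
  shows "(1 - b * d) * suminf (gauss_term q b d) = (1 - d) * suminf (gauss_term q b (d * q))"
proof -
  let ?G = "\<lambda>m. (1 - q ^ m) * gauss_term q b d m"
  have bd': "b * (d * q) * q ^ k \<noteq> 1" for k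
    using bd[of "Suc k"] by (simp add: mult_ac)
  note s = summable_gauss_term[OF q bd] summable_gauss_term[OF q bd']
  have "?G \<longlonglongrightarrow> (1 - 0) * 0"
    using q by (intro tendsto_intros summable_LIMSEQ_zero s LIMSEQ_power_zero)
  \<comment> \<open>Since \<open>?G\<close> is 0 at the start and in the limit, the telescoping sum
    is 0.\<close>
  then have "(\<lambda>m. ?G m - ?G (Suc m)) sums (?G 0 - (1 - 0) * 0)"
    by (rule telescope_sums')
  then have "(\<lambda>m. (1 - b * d) * (?G m - ?G (Suc m))) sums ((1 - b * d) * (?G 0 - (1 - 0) * 0))"
    by (rule sums_mult)
  then have "(\<lambda>m. (1 - b * d) * gauss_term q b d m - (1 - d) * gauss_term q b (d * q) m) sums 0"
    by (simp add: gauss_term_telescope[OF q bd])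
  moreover have "(\<lambda>m. (1 - b * d) * gauss_term q b d m - (1 - d) * gauss_term q b (d * q) m) sums
      ((1 - b * d) * suminf (gauss_term q b d) - (1 - d) * suminf (gauss_term q b (d * q)))"
    by (intro sums_diff sums_mult summable_sums s)
  ultimately show ?thesis
    using sums_unique2 by fastforce
qed

lemma suminf_gauss_term_iterate:
  assumes q: "norm q < 1" and bd: "\<And>k. b * d * q ^ k \<noteq> 1"
  shows "qpoch (b * d) q N * suminf (gauss_term q b d)
       = qpoch d q N * suminf (gauss_term q b (d * q ^ N))"
proof (induction N)
  case (Suc N)
  have bd': "b * (d * q ^ N) * q ^ k \<noteq> 1" for k
    using bd[of "N + k"] by (simp add: power_add mult_ac)
  have step: "(1 - b * d * q ^ N) * suminf (gauss_term q b (d * q ^ N))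
      = (1 - d * q ^ N) * suminf (gauss_term q b (d * q ^ Suc N))"
    using suminf_gauss_term_shift[OF q bd'] by (simp add: mult_ac)
  have "qpoch (b * d) q (Suc N) * suminf (gauss_term q b d)
      = (1 - b * d * q ^ N) * (qpoch (b * d) q N * suminf (gauss_term q b d))"
    by (simp only: qpoch_Suc mult_ac)
  also have "\<dots> = qpoch d q N * ((1 - b * d * q ^ N) * suminf (gauss_term q b (d * q ^ N)))"
    by (simp only: Suc.IH mult.left_commute)
  also have "\<dots> = qpoch d q (Suc N) * suminf (gauss_term q b (d * q ^ Suc N))"
    unfolding step by (simp only: qpoch_Suc mult.assoc)
  finally show ?case .
qed simp

text \<open>In the iterated relation the argument \<open>d * q ^ N\<close> tends to 0, so only the
  term \<open>m = 0\<close> survives and the sum on the right tends to 1. The two finite products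
  become infinite ones.\<close>

theorem gauss_term_sums:
  assumes q: "norm q < 1" and bd: "\<And>k. b * d * q ^ k \<noteq> 1"
  shows "gauss_term q b d sums (qpoch_inf d q / qpoch_inf (b * d) q)"
proof -
  obtain K where K: "\<And>N m. norm (gauss_term q b (d * q ^ N) m)
                     \<le> K * (norm (d * q ^ N) ^ m * norm q ^ (m choose 2))"
    using gauss_term_bound[OF q bd] by metis
  have "K \<ge> 0"
    using order.trans[OF norm_ge_zero K[of 0 0]] by (simp add: numeral_2_eq_2)
  have K': "norm (gauss_term q b (d * q ^ N) m) \<le> K * (norm d ^ m * norm q ^ (m choose 2))" for N m
  proof (rule order.trans[OF K])
    have "norm (d * q ^ N) \<le> norm d * 1"
      using q unfolding norm_mult norm_power by (intro mult_left_mono power_le_one) auto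
    then show "K * (norm (d * q ^ N) ^ m * norm q ^ (m choose 2))
        \<le> K * (norm d ^ m * norm q ^ (m choose 2))"
      using \<open>K \<ge> 0\<close> by (intro mult_left_mono mult_right_mono power_mono) auto
  qed
  have lim: "(\<lambda>N. gauss_term q b (d * q ^ N) m) \<longlonglongrightarrow> (if m = 0 then 1 else 0)" for m
  proof (cases m)
    case (Suc j)
    have dq: "(\<lambda>N. norm (d * q ^ N)) \<longlonglongrightarrow> 0"
      using q by (intro tendsto_norm_zero tendsto_mult_right_zero LIMSEQ_power_zero)
    have "(\<lambda>N. K * (norm (d * q ^ N) ^ m * norm q ^ (m choose 2))) \<longlonglongrightarrow>
            K * (0 ^ m * norm q ^ (m choose 2))"
      by (intro tendsto_intros dq)
    then have "(\<lambda>N. K * (norm (d * q ^ N) ^ m * norm q ^ (m choose 2))) \<longlonglongrightarrow> 0"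
      using Suc by simp
    then have "(\<lambda>N. gauss_term q b (d * q ^ N) m) \<longlonglongrightarrow> 0"
      by (rule Lim_null_comparison[rotated]) (use K in simp)
    then show ?thesis using Suc by simp
  qed simp
  have "(\<lambda>N. suminf (gauss_term q b (d * q ^ N))) \<longlonglongrightarrow> (\<Sum>m. if m = 0 then 1 else 0 :: complex)"
  proof (rule tannerys_theorem[THEN conjunct2, THEN conjunct2])
    show "summable (\<lambda>m. K * (norm d ^ m * norm q ^ (m choose 2)))"
      using q by (intro summable_mult summable_power_choose_two) auto
    show "\<forall>\<^sub>F (m, N) in sequentially \<times>\<^sub>F sequentially. norm (gauss_term q b (d * q ^ N) m)
        \<le> K * (norm d ^ m * norm q ^ (m choose 2))"
      by (rule always_eventually) (use K' in auto)
  qed (use lim in auto)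
  also have "(\<Sum>m. if m = 0 then 1 else 0 :: complex) = 1"
    using sums_single[of 0 "\<lambda>_. 1 :: complex"] by (simp add: sums_iff)
  finally have "(\<lambda>N. qpoch d q N * suminf (gauss_term q b (d * q ^ N))) \<longlonglongrightarrow> qpoch_inf d q * 1"
    by (intro tendsto_mult qpoch_LIMSEQ q)
  moreover have "(\<lambda>N. qpoch (b * d) q N * suminf (gauss_term q b d)) \<longlonglongrightarrow>
      qpoch_inf (b * d) q * suminf (gauss_term q b d)"
    by (intro tendsto_intros qpoch_LIMSEQ q)
  ultimately have "qpoch_inf (b * d) q * suminf (gauss_term q b d) = qpoch_inf d q"
    unfolding suminf_gauss_term_iterate[OF q bd] using LIMSEQ_unique by fastforce
  then have "suminf (gauss_term q b d) = qpoch_inf d q / qpoch_inf (b * d) q"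
    using qpoch_inf_nonzero[OF q bd] by (simp add: field_simps)
  then show ?thesis
    using summable_sums[OF summable_gauss_term[OF q bd]] by simp
qed

section \<open>The finite triple product\<close>

text \<open>The kernel of Bailey pairs relative to 1. The guard encodes the convention that
  \<open>1 / (q;q)_j\<close> is 0 for negative \<open>j\<close>; truncated subtraction would give a
  nonzero value.\<close>

definition bailey_kernel :: "complex \<Rightarrow> nat \<Rightarrow> nat \<Rightarrow> complex" where
  "bailey_kernel q n k = (if k \<le> n then 1 / (qpoch q q (n - k) * qpoch q q (n + k)) else 0)"

lemma bailey_kernel_eq_0: "n < k \<Longrightarrow> bailey_kernel q n k = 0"
  by (simp add: bailey_kernel_def)

section \<open>The sequence V_n + V_{n-1}\<close>

definition chebyshev_VV :: "complex \<Rightarrow> nat \<Rightarrow> complex" where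
  "chebyshev_VV x n = chebyshev_V (int n) x + chebyshev_V (int n - 1) x"

lemma chebyshev_VV_0 [simp]: "chebyshev_VV x 0 = 1"
  by (simp add: chebyshev_VV_def chebyshev_V.simps)

lemma chebyshev_VV_1 [simp]: "chebyshev_VV x (Suc 0) = 2 * x"
  by (simp add: chebyshev_VV_def chebyshev_V.simps)

text \<open>For \<open>n > 0\<close> these are the values \<open>2 * T\<^sub>n(x)\<close> of the polynomials of the first kind; at
  \<open>n = 0\<close> the value is \<open>1\<close> and not \<open>2\<close>, whence the case distinction.\<close>

lemma chebyshev_VV_rec:
  "2 * x * chebyshev_VV x (Suc n) =
     chebyshev_VV x (Suc (Suc n)) + (if n = 0 then 2 else chebyshev_VV x n)"
proof -
  have V: "chebyshev_V (int n + 2) x = 2 * x * chebyshev_V (int n + 1) x - chebyshev_V (int n) x" for n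
    by (subst chebyshev_V.simps) (simp add: algebra_simps)
  show ?thesis
  proof (cases n)
    case 0
    then show ?thesis
      using V[of 0] by (simp add: chebyshev_VV_def chebyshev_V.simps[of 1] chebyshev_V.simps[of 0] algebra_simps)
  next
    case (Suc j)
    then show ?thesis
      using V[of j] V[of "Suc j"] by (simp add: chebyshev_VV_def algebra_simps)
  qed
qed

text \<open>Geometric growth is enough, because the coefficients decay like a power with quadratic
  exponent. The summand 2 in the base absorbs the exceptional coefficient 2 of the recurrence at
  index 0.\<close>

lemma norm_chebyshev_VV_le: "norm (chebyshev_VV x n) \<le> (2 * norm x + 2) ^ n"
proof (induction n rule: less_induct)
  case (less n)
  let ?R = "2 * norm x + 2"
  consider "n = 0" | "n = 1" | j where "n = Suc (Suc j)"
    by (metis One_nat_def not0_implies_Suc)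
  then show ?case
  proof cases
    case 3
    have "chebyshev_VV x n = 2 * x * chebyshev_VV x (Suc j) - (if j = 0 then 2 else chebyshev_VV x j)"
      using chebyshev_VV_rec[of x j] 3 by (simp add: algebra_simps)
    then have "norm (chebyshev_VV x n) \<le> norm (2 * x * chebyshev_VV x (Suc j))
        + norm (if j = 0 then 2 else chebyshev_VV x j)"
      by (metis norm_triangle_ineq4)
    also have "\<dots> \<le> 2 * norm x * ?R ^ Suc j + 2 * ?R ^ j"
    proof (rule add_mono)
      show "norm (2 * x * chebyshev_VV x (Suc j)) \<le> 2 * norm x * ?R ^ Suc j"
        using less[of "Suc j"] 3 by (simp add: norm_mult mult_left_mono del: power_Suc)
      have "norm (chebyshev_VV x j) \<le> ?R ^ j"
        using less[of j] 3 by simp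
      moreover have "?R ^ j \<ge> 0" by simp
      ultimately have "norm (chebyshev_VV x j) \<le> 2 * ?R ^ j"
        by linarith
      then show "norm (if j = 0 then 2 else chebyshev_VV x j) \<le> 2 * ?R ^ j"
        by auto
    qed
    also have "\<dots> \<le> 2 * norm x * ?R ^ Suc j + 2 * ?R ^ Suc j"
    proof -
      have "1 * ?R ^ j \<le> ?R * ?R ^ j"
        by (intro mult_right_mono) auto
      then show ?thesis by simp
    qed
    also have "\<dots> = ?R ^ n"
      using 3 by (simp add: algebra_simps)
    finally show ?thesis .
  qed (auto simp: norm_mult)
qed

text \<open>Summation by parts: multiplication by \<open>2 * x\<close> is moved from the polynomials
  to the coefficients, where it becomes the sum of the two neighbours. The extra terms on the left
  are boundary terms.\<close>

lemma chebyshev_VV_sum_rec: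
  "2 * x * (\<Sum>k\<le>n. chebyshev_VV x k * u k)
     + (if n = 0 then 2 else chebyshev_VV x n) * u (Suc n) + chebyshev_VV x (Suc n) * u (Suc (Suc n))
   = 2 * u 1 + (\<Sum>k\<le>n. chebyshev_VV x (Suc k) * (u k + u (Suc (Suc k))))"
proof (induction n)
  case (Suc n)
  have "2 * x * (chebyshev_VV x (Suc n) * u (Suc n)) =
     (chebyshev_VV x (Suc (Suc n)) + (if n = 0 then 2 else chebyshev_VV x n)) * u (Suc n)"
    using chebyshev_VV_rec[of x n] by (simp add: mult.assoc[symmetric])
  with Suc show ?case
    by (simp add: algebra_simps)
qed (simp add: algebra_simps)

text \<open>This compares coefficients at index \<open>Suc k\<close> when the triple product gains a
  factor; here \<open>q\<close> stands for the squared base. Each kernel value on the right is the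
  one on the left times a polynomial in powers of \<open>q\<close>.\<close>

lemma bailey_kernel_rec_Suc:
  assumes q: "norm q < 1" and k: "k \<le> n"
  shows "(1 - q ^ (2 * n + 1)) * (1 - q ^ (2 * n + 2)) * bailey_kernel q (Suc n) (Suc k)
     = (1 + q ^ (2 * n + 1)) * bailey_kernel q n (Suc k)
       + q ^ (n - k) * bailey_kernel q n k + q ^ (n + k + 2) * bailey_kernel q n (Suc (Suc k))"
proof -
  obtain j where n: "n = k + j"
    using k le_Suc_ex by blast
  define H where "H = bailey_kernel q (Suc n) (Suc k)"
  have nz: "1 - q ^ Suc m \<noteq> 0" "qpoch q q m \<noteq> 0" for m
    using mult_power_neq_1[OF q q] qpoch_nonzero[OF mult_power_neq_1[OF q q]] by auto
  have dec: "1 / qpoch q q m = (1 - q ^ Suc m) * (1 / qpoch q q (Suc m))" for m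
    using nz[of m] by (simp add: qpoch_Suc)
  have dec2: "1 / qpoch q q m
      = (1 - q ^ Suc m) * (1 - q ^ Suc (Suc m)) * (1 / qpoch q q (Suc (Suc m)))" for m
    by (subst dec[of m], subst dec[of "Suc m"]) (simp only: mult.assoc)
  have H: "H = 1 / qpoch q q j * (1 / qpoch q q (Suc (Suc (2 * k + j))))"
    by (simp add: H_def bailey_kernel_def n mult_2 add_ac)
  have C0: "bailey_kernel q n k = H * ((1 - q ^ (2 * k + j + 1)) * (1 - q ^ (2 * k + j + 2)))"
  proof -
    have "bailey_kernel q n k = 1 / qpoch q q j * (1 / qpoch q q (2 * k + j))"
      by (simp add: bailey_kernel_def n mult_2 add_ac)
    then show ?thesis
      unfolding H dec2[of "2 * k + j"] by (simp add: mult_ac)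
  qed
  show ?thesis
  proof (cases j)
    case 0
    then have "bailey_kernel q n (Suc k) = 0" "bailey_kernel q n (Suc (Suc k)) = 0"
      by (simp_all add: n bailey_kernel_eq_0)
    then show ?thesis
      using C0 by (simp add: n 0 H_def)
  next
    case (Suc i)
    have C1: "bailey_kernel q n (Suc k) = H * ((1 - q ^ Suc i) * (1 - q ^ (2 * k + i + 3)))"
    proof -
      have "bailey_kernel q n (Suc k) = 1 / qpoch q q i * (1 / qpoch q q (Suc (Suc (2 * k + i))))"
        by (simp add: bailey_kernel_def n Suc mult_2 add_ac)
      then show ?thesis
        unfolding H Suc dec[of i] dec[of "Suc (Suc (2 * k + i))"]
        by (simp add: numeral_3_eq_3 mult_ac)
    qed
    \<comment> \<open>For \<open>i = 0\<close> the index lies beyond \<open>n\<close>, and the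
      factor \<open>1 - q ^ i\<close> vanishes accordingly.\<close>
    have C2: "bailey_kernel q n (Suc (Suc k)) = H * ((1 - q ^ Suc i) * (1 - q ^ i))"
    proof (cases i)
      case 0
      then show ?thesis by (simp add: n Suc bailey_kernel_eq_0)
    next
      case i: (Suc l)
      have "bailey_kernel q n (Suc (Suc k)) = 1 / qpoch q q l * (1 / qpoch q q (Suc (Suc (2 * k + j))))"
        by (simp add: bailey_kernel_def n Suc i mult_2 add_ac)
      then show ?thesis
        unfolding H Suc i dec2[of l] by (simp add: mult_ac)
    qed
    define a where "a = q ^ i"
    define y where "y = q ^ k"
    \<comment> \<open>Writing \<open>q^1\<close> instead of \<open>q\<close> lets each right side
      merge into a single power, so that only exponents are compared.\<close>
    have pw: "q ^ (2 * n + 1) = y^2 * a^2 * q^3" "q ^ (2 * n + 2) = y^2 * a^2 * q^4"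
      "q ^ (n - k) = a * q^1" "q ^ (n + k + 2) = y^2 * a * q^3"
      "q ^ (2 * k + j + 1) = y^2 * a * q^2" "q ^ (2 * k + j + 2) = y^2 * a * q^3"
      "q ^ Suc i = a * q^1" "q ^ (2 * k + i + 3) = y^2 * a * q^3"
      unfolding a_def y_def n Suc power_mult[symmetric] power_add[symmetric]
      by (rule arg_cong[where f = "(^) q"], simp)+
    show ?thesis
      unfolding H_def[symmetric] C0 C1 C2 unfolding pw a_def[symmetric]
      by (simp add: algebra_simps eval_nat_numeral)
  qed
qed

text \<open>At the centre the neighbours of index 1 and -1 coincide, hence the factor 2.\<close>

lemma bailey_kernel_rec_0:
  assumes q: "norm q < 1"
  shows "(1 - q ^ (2 * n + 1)) * (1 - q ^ (2 * n + 2)) * bailey_kernel q (Suc n) 0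
     = (1 + q ^ (2 * n + 1)) * bailey_kernel q n 0 + 2 * q ^ Suc n * bailey_kernel q n 1"
proof -
  define H where "H = bailey_kernel q (Suc n) 0"
  have nz: "1 - q ^ Suc m \<noteq> 0" "qpoch q q m \<noteq> 0" for m
    using mult_power_neq_1[OF q q] qpoch_nonzero[OF mult_power_neq_1[OF q q]] by auto
  have C0: "bailey_kernel q n 0 = H * (1 - q ^ Suc n)^2"
    using nz[of n] by (simp add: H_def bailey_kernel_def qpoch_Suc power2_eq_square)
  have C1: "bailey_kernel q n 1 = H * ((1 - q ^ Suc n) * (1 - q ^ n))"
  proof (cases n)
    case 0
    then show ?thesis by (simp add: bailey_kernel_eq_0)
  next
    case (Suc l)
    then show ?thesis
      using nz[of n] nz[of l] by (simp add: H_def bailey_kernel_def qpoch_Suc)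
  qed
  define a where "a = q ^ n"
  have pw: "q ^ (2 * n + 1) = a^2 * q" "q ^ (2 * n + 2) = a^2 * q^2" "q ^ Suc n = a * q"
    by (simp_all add: a_def power_add power_mult power2_eq_square mult_2)
  show ?thesis
    unfolding H_def[symmetric] C0 C1 unfolding pw a_def[symmetric] by algebra
qed

text \<open>With \<open>2 * x = z + 1/z\<close> the factors are
  \<open>(1 + z q^(2i-1)) (1 + q^(2i-1) / z)\<close>. The induction avoids \<open>z\<close>: the new
  factor acts on the coefficients by summation by parts, and the kernel recurrences describe the
  same action.\<close>

theorem finite_triple_product:
  fixes q x :: complex
  assumes q: "norm q < 1"
  shows "(\<Prod>i=1..n. 1 + 2 * x * q ^ (2 * i - 1) + q ^ (4 * i - 2)) / qpoch (q\<^sup>2) (q\<^sup>2) (2 * n)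
       = (\<Sum>k\<le>n. chebyshev_VV x k * (q ^ k\<^sup>2 * bailey_kernel (q\<^sup>2) n k))"
proof (induction n)
  case 0
  show ?case by (simp add: bailey_kernel_def)
next
  case (Suc n)
  let ?Q = "q\<^sup>2" and ?T = "chebyshev_VV x"
  define u where "u k = q ^ k\<^sup>2 * bailey_kernel ?Q n k" for k
  define v where "v k = q ^ k\<^sup>2 * bailey_kernel ?Q (Suc n) k" for k
  \<comment> \<open>The two factors that \<open>qpoch ?Q ?Q (2 * n)\<close> gains in the
    step.\<close>
  define D where "D = (1 - ?Q ^ (2 * n + 1)) * (1 - ?Q ^ (2 * n + 2))"
  have Q: "norm ?Q < 1"
    using q by (simp add: norm_power power_less_one_iff)
  have nz: "D \<noteq> 0"
    using mult_power_neq_1[OF Q Q, of "2 * n"] mult_power_neq_1[OF Q Q, of "2 * n + 1"]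
    by (auto simp: D_def)
  have u0: "u k = 0" if "k > n" for k
    using that by (simp add: u_def bailey_kernel_eq_0)
  have v0: "D * v 0 = (1 + q ^ (4 * n + 2)) * u 0 + q ^ (2 * n + 1) * (2 * u 1)"
    using bailey_kernel_rec_0[OF Q, of n]
    by (simp add: D_def u_def v_def power_mult[symmetric] power_add[symmetric] algebra_simps)
  have vS: "D * v (Suc k) = (1 + q ^ (4 * n + 2)) * u (Suc k) + q ^ (2 * n + 1) * (u k + u (Suc (Suc k)))"
    if "k \<le> n" for k
  proof -
    have e1: "q ^ (Suc k)\<^sup>2 * ?Q ^ (n - k) = q ^ (2 * n + 1) * q ^ k\<^sup>2"
    proof -
      have "(Suc k)\<^sup>2 + 2 * (n - k) = 2 * n + 1 + k\<^sup>2"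
        using that by (simp add: power2_eq_square)
      then show ?thesis by (metis power_add power_mult)
    qed
    have e2: "q ^ (Suc k)\<^sup>2 * ?Q ^ (n + k + 2) = q ^ (2 * n + 1) * q ^ (Suc (Suc k))\<^sup>2"
    proof -
      have "(Suc k)\<^sup>2 + 2 * (n + k + 2) = 2 * n + 1 + (Suc (Suc k))\<^sup>2"
        by (simp add: power2_eq_square)
      then show ?thesis by (metis power_add power_mult)
    qed
    have e3: "?Q ^ (2 * n + 1) = q ^ (4 * n + 2)"
      by (simp add: power_mult[symmetric] power_add[symmetric])
    have "D * v (Suc k) = q ^ (Suc k)\<^sup>2 * ((1 + ?Q ^ (2 * n + 1)) * bailey_kernel ?Q n (Suc k)
       + ?Q ^ (n - k) * bailey_kernel ?Q n k + ?Q ^ (n + k + 2) * bailey_kernel ?Q n (Suc (Suc k)))"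
      unfolding bailey_kernel_rec_Suc[OF Q that, symmetric] by (simp only: D_def v_def mult_ac)
    also have "\<dots> = (1 + ?Q ^ (2 * n + 1)) * u (Suc k)
       + (q ^ (Suc k)\<^sup>2 * ?Q ^ (n - k)) * bailey_kernel ?Q n k
       + (q ^ (Suc k)\<^sup>2 * ?Q ^ (n + k + 2)) * bailey_kernel ?Q n (Suc (Suc k))"
      by (simp only: u_def distrib_left mult_ac)
    also have "\<dots> = (1 + q ^ (4 * n + 2)) * u (Suc k) + q ^ (2 * n + 1) * (u k + u (Suc (Suc k)))"
      unfolding e1 e2 e3 by (simp only: u_def distrib_left mult_ac add_ac)
    finally show ?thesis .
  qed
  have "D * (\<Sum>k\<le>Suc n. ?T k * v k) = D * v 0 + (\<Sum>k\<le>n. ?T (Suc k) * (D * v (Suc k)))"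
    by (subst sum.atMost_Suc_shift) (simp add: distrib_left sum_distrib_left mult_ac)
  also have "(\<Sum>k\<le>n. ?T (Suc k) * (D * v (Suc k))) =
      (\<Sum>k\<le>n. (1 + q ^ (4 * n + 2)) * (?T (Suc k) * u (Suc k))
        + q ^ (2 * n + 1) * (?T (Suc k) * (u k + u (Suc (Suc k)))))"
    by (intro sum.cong refl) (simp add: vS algebra_simps)
  also have "\<dots> = (1 + q ^ (4 * n + 2)) * (\<Sum>k\<le>n. ?T (Suc k) * u (Suc k))
        + q ^ (2 * n + 1) * (\<Sum>k\<le>n. ?T (Suc k) * (u k + u (Suc (Suc k))))"
    by (simp only: sum.distrib sum_distrib_left)
  also have "D * v 0 + \<dots> = (1 + q ^ (4 * n + 2)) * (u 0 + (\<Sum>k\<le>n. ?T (Suc k) * u (Suc k)))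
      + q ^ (2 * n + 1) * (2 * u 1 + (\<Sum>k\<le>n. ?T (Suc k) * (u k + u (Suc (Suc k)))))"
    unfolding v0 by (simp only: distrib_left add_ac)
  \<comment> \<open>The boundary terms vanish because \<open>u\<close> is 0 beyond
    \<open>n\<close>.\<close>
  also have "2 * u 1 + (\<Sum>k\<le>n. ?T (Suc k) * (u k + u (Suc (Suc k)))) = 2 * x * (\<Sum>k\<le>n. ?T k * u k)"
    using chebyshev_VV_sum_rec[of x u n] by (simp add: u0)
  also have "u 0 + (\<Sum>k\<le>n. ?T (Suc k) * u (Suc k)) = (\<Sum>k\<le>Suc n. ?T k * u k)"
    by (subst sum.atMost_Suc_shift) simp
  also have "\<dots> = (\<Sum>k\<le>n. ?T k * u k)"
    by (simp add: u0)
  finally have main: "D * (\<Sum>k\<le>Suc n. ?T k * v k)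
      = (1 + 2 * x * q ^ (2 * n + 1) + q ^ (4 * n + 2)) * (\<Sum>k\<le>n. ?T k * u k)"
    by (simp add: algebra_simps)
  have "(\<Prod>i=1..Suc n. 1 + 2 * x * q ^ (2 * i - 1) + q ^ (4 * i - 2)) / qpoch ?Q ?Q (2 * Suc n)
     = (\<Prod>i=1..n. 1 + 2 * x * q ^ (2 * i - 1) + q ^ (4 * i - 2)) / qpoch ?Q ?Q (2 * n)
       * (1 + 2 * x * q ^ (2 * n + 1) + q ^ (4 * n + 2)) / D"
    by (simp add: qpoch_Suc D_def mult_ac)
  also have "\<dots> = (\<Sum>k\<le>Suc n. ?T k * v k)"
    unfolding Suc.IH u_def[symmetric] using main nz by (simp add: field_simps del: sum.atMost_Suc)
  finally show ?case
    by (simp only: v_def)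
qed

section \<open>The identity\<close>

text \<open>Terms with \<open>n < k\<close> vanish. After the shift \<open>n = m + k\<close> both
  factorials split at \<open>k\<close> and \<open>2 * k\<close>, leaving a constant times the
  summable series above.\<close>

lemma bailey_kernel_sums:
  fixes q :: complex
  assumes q: "norm q < 1"
  shows "(\<lambda>n. q ^ (n\<^sup>2 + n) * qpoch (-1) (q\<^sup>2) n * bailey_kernel (q\<^sup>2) n k) sums
     (qpoch_inf (- (q\<^sup>2)) (q\<^sup>2) / qpoch_inf (q\<^sup>2) (q\<^sup>2)
       * (qpoch (-1) (q\<^sup>2) k * q ^ (k\<^sup>2 + k) / qpoch (- (q\<^sup>2)) (q\<^sup>2) k))"
    (is "?f sums ?s")
proof -
  let ?Q = "q\<^sup>2"
  define b where "b = - (?Q ^ k)"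
  define d where "d = - (?Q * ?Q ^ k)"
  define A where "A = q ^ (k\<^sup>2 + k) * qpoch (-1) ?Q k / qpoch ?Q ?Q (2 * k)"
  have Q: "norm ?Q < 1"
    using q by (simp add: norm_power power_less_one_iff)
  have bd_eq: "b * d = ?Q * ?Q ^ (2 * k)"
    by (simp add: b_def d_def power_add mult_2)
  have bd: "b * d * ?Q ^ j \<noteq> 1" for j
    unfolding bd_eq using mult_power_neq_1[OF Q Q, of "2 * k + j"] by (simp add: power_add mult_ac)
  have term_eq: "?f (m + k) = A * gauss_term ?Q b d m" for m
  proof -
    \<comment> \<open>Apart from \<open>k\<^sup>2 + k\<close> the exponent is even, so the rest is a
      power of \<open>?Q\<close>: one part is \<open>(- d) ^ m\<close>, the other the triangular
      factor.\<close>
    have "(m + k)\<^sup>2 + (m + k) = (k\<^sup>2 + k) + 2 * (m * (k + 1)) + 2 * (m choose 2)"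
      using two_choose_two[of m] by (simp add: power2_eq_square algebra_simps)
    then have "q ^ ((m + k)\<^sup>2 + (m + k)) = q ^ (k\<^sup>2 + k) * ?Q ^ (m * (k + 1)) * ?Q ^ (m choose 2)"
      by (metis power_add power_mult)
    also have "?Q ^ (m * (k + 1)) = (- d) ^ m"
      by (simp add: d_def power_mult[symmetric] power_mult_distrib power_add mult_ac)
    finally have e1: "q ^ ((m + k)\<^sup>2 + (m + k)) = q ^ (k\<^sup>2 + k) * (- d) ^ m * ?Q ^ (m choose 2)" .
    have e2: "qpoch (-1) ?Q (m + k) = qpoch (-1) ?Q k * qpoch b ?Q m"
      by (subst add.commute) (simp add: qpoch_add b_def)
    have e3: "bailey_kernel ?Q (m + k) k = 1 / (qpoch ?Q ?Q m * (qpoch ?Q ?Q (2 * k) * qpoch (b * d) ?Q m))"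
      unfolding bd_eq qpoch_add[symmetric] by (simp add: bailey_kernel_def mult_2 add_ac)
    show ?thesis
      unfolding e1 e2 e3 A_def gauss_term_def by (simp add: mult_ac)
  qed
  have "(\<lambda>m. ?f (m + k)) sums (A * (qpoch_inf d ?Q / qpoch_inf (b * d) ?Q))"
    unfolding term_eq by (intro sums_mult gauss_term_sums Q bd)
  also have "A * (qpoch_inf d ?Q / qpoch_inf (b * d) ?Q) = ?s"
  proof -
    have "norm (- ?Q) < 1" using Q by simp
    then have nz: "qpoch ?Q ?Q (2 * k) \<noteq> 0" "qpoch (- ?Q) ?Q k \<noteq> 0"
      using qpoch_nonzero[OF mult_power_neq_1[OF Q]] Q by blast+
    \<comment> \<open>The products at \<open>d\<close> and \<open>b * d\<close> are tails of those
      at \<open>- ?Q\<close> and \<open>?Q\<close>.\<close>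
    have "qpoch_inf (- ?Q) ?Q = qpoch (- ?Q) ?Q k * qpoch_inf d ?Q"
      using qpoch_inf_split[OF Q, of "- ?Q" k] by (simp add: d_def)
    moreover have "qpoch_inf ?Q ?Q = qpoch ?Q ?Q (2 * k) * qpoch_inf (b * d) ?Q"
      using qpoch_inf_split[OF Q, of ?Q "2 * k"] by (simp add: bd_eq)
    ultimately show ?thesis
      using nz by (simp add: A_def)
  qed
  finally show ?thesis
    by (subst (asm) sums_zero_iff_shift) (auto simp: bailey_kernel_eq_0)
qed

text \<open>Uniformity in both \<open>N\<close> and \<open>k\<close> is the point: the later
  majorant in \<open>k\<close> must not depend on the cut-off \<open>N\<close>. It comes from a
  geometric series.\<close>

lemma bailey_kernel_partial_sums_bounded:
  fixes q :: complex
  assumes q: "norm q < 1"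
  obtains C where "C \<ge> 0"
    "\<And>N k. norm (\<Sum>n<N. q ^ (n\<^sup>2 + n) * qpoch (-1) (q\<^sup>2) n * bailey_kernel (q\<^sup>2) n k) \<le> C"
proof -
  let ?Q = "q\<^sup>2"
  have Q: "norm ?Q < 1"
    using q by (simp add: norm_power power_less_one_iff)
  obtain B where B: "B > 0" "\<And>n. norm (qpoch (-1) ?Q n) \<le> B"
    using qpoch_bounded[OF Q] by metis
  obtain F where F: "F > 0" "\<And>n. norm (inverse (qpoch ?Q ?Q n)) \<le> F"
    using inverse_qpoch_bounded[OF Q mult_power_neq_1[OF Q Q]] by metis
  have "norm (bailey_kernel ?Q n k) \<le> F * F" for n k
  proof -
    have "norm (inverse (qpoch ?Q ?Q (n - k)) * inverse (qpoch ?Q ?Q (n + k))) \<le> F * F"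
      unfolding norm_mult using F by (intro mult_mono) (auto simp: less_imp_le)
    then show ?thesis
      using F(1) by (simp add: bailey_kernel_def divide_inverse)
  qed
  moreover have "norm (q ^ (n\<^sup>2 + n)) \<le> norm q ^ n" for n
    using q unfolding norm_power by (intro power_decreasing) auto
  ultimately have bound:
    "norm (q ^ (n\<^sup>2 + n) * qpoch (-1) ?Q n * bailey_kernel ?Q n k) \<le> norm q ^ n * B * (F * F)" for n k
    unfolding norm_mult using B F
    by (intro mult_mono mult_nonneg_nonneg) (auto simp: less_imp_le)
  have sm: "summable (\<lambda>n. norm q ^ n * B * (F * F))"
    using q by (intro summable_mult2 summable_geometric) auto
  have "norm (\<Sum>n<N. q ^ (n\<^sup>2 + n) * qpoch (-1) ?Q n * bailey_kernel ?Q n k)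
      \<le> (\<Sum>n. norm q ^ n * B * (F * F))" for N k
  proof -
    have "norm (\<Sum>n<N. q ^ (n\<^sup>2 + n) * qpoch (-1) ?Q n * bailey_kernel ?Q n k)
        \<le> (\<Sum>n<N. norm q ^ n * B * (F * F))"
      by (intro sum_norm_le bound)
    also have "\<dots> \<le> (\<Sum>n. norm q ^ n * B * (F * F))"
      using B F by (intro sum_le_suminf sm) auto
    finally show ?thesis .
  qed
  moreover have "(\<Sum>n. norm q ^ n * B * (F * F)) \<ge> 0"
    using B F by (intro suminf_nonneg sm) auto
  ultimately show thesis by (intro that)
qed

theorem theorem6p1:
  fixes q x :: complex
  assumes "norm q < 1"
  shows "summable (\<lambda>n::nat. q ^ (n\<^sup>2 + n) * qpoch (-1) (q\<^sup>2) n
            * (\<Prod>i=1..n. 1 + 2 * x * q ^ (2 * i - 1) + q ^ (4 * i - 2))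
            / qpoch (q\<^sup>2) (q\<^sup>2) (2 * n))
    \<and> summable (\<lambda>n::nat. qpoch (-1) (q\<^sup>2) n * q ^ (2 * n\<^sup>2 + n) / qpoch (- (q\<^sup>2)) (q\<^sup>2) n
            * (chebyshev_V (int n) x + chebyshev_V (int n - 1) x))
    \<and> (\<Sum>n::nat. q ^ (n\<^sup>2 + n) * qpoch (-1) (q\<^sup>2) n
            * (\<Prod>i=1..n. 1 + 2 * x * q ^ (2 * i - 1) + q ^ (4 * i - 2))
            / qpoch (q\<^sup>2) (q\<^sup>2) (2 * n))
      = qpoch_inf (- (q\<^sup>2)) (q\<^sup>2) / qpoch_inf (q\<^sup>2) (q\<^sup>2)
        * (\<Sum>n::nat. qpoch (-1) (q\<^sup>2) n * q ^ (2 * n\<^sup>2 + n) / qpoch (- (q\<^sup>2)) (q\<^sup>2) n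
            * (chebyshev_V (int n) x + chebyshev_V (int n - 1) x))"
    (is "summable ?L \<and> summable ?R \<and> suminf ?L = ?c * suminf ?R")
proof -
  let ?Q = "q\<^sup>2"
  define w where "w n k = q ^ (n\<^sup>2 + n) * qpoch (-1) ?Q n * bailey_kernel ?Q n k" for n k
  define g where "g k = chebyshev_VV x k * q ^ k\<^sup>2" for k
  \<comment> \<open>The inner sum is cut off at \<open>N\<close>, so the interchange becomes a limit
    in \<open>N\<close> of sums over \<open>k\<close>.\<close>
  define a where "a k N = g k * (\<Sum>n<N. w n k)" for k N
  obtain C where C: "C \<ge> 0" "\<And>N k. norm (\<Sum>n<N. w n k) \<le> C"
    using bailey_kernel_partial_sums_bounded[OF assms, folded w_def] by blast
  define M where "M k = (2 * norm x + 2) ^ k * norm q ^ (k choose 2) * C" for k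
  have Q: "norm ?Q < 1" "norm (- ?Q) < 1"
    using assms by (simp_all add: norm_power power_less_one_iff)

  have L: "?L n = (\<Sum>k\<le>n. g k * w n k)" for n
  proof -
    have "?L n = q ^ (n\<^sup>2 + n) * qpoch (-1) ?Q n *
        ((\<Prod>i=1..n. 1 + 2 * x * q ^ (2 * i - 1) + q ^ (4 * i - 2)) / qpoch ?Q ?Q (2 * n))"
      by simp
    also have "\<dots> = (\<Sum>k\<le>n. g k * w n k)"
      unfolding finite_triple_product[OF assms] sum_distrib_left by (simp add: g_def w_def mult_ac)
    finally show ?thesis .
  qed
  \<comment> \<open>The kernel is triangular, so for \<open>n < N\<close> only \<open>k < N\<close>
    contributes and the swap is finite.\<close>
  have partial: "(\<Sum>n<N. ?L n) = (\<Sum>k. a k N)" for N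
  proof -
    have "(\<Sum>n<N. ?L n) = (\<Sum>n<N. \<Sum>k<N. g k * w n k)"
    proof (rule sum.cong[OF refl])
      fix n assume "n \<in> {..<N}"
      then show "?L n = (\<Sum>k<N. g k * w n k)"
        unfolding L by (intro sum.mono_neutral_left) (auto simp: w_def bailey_kernel_eq_0)
    qed
    also have "\<dots> = (\<Sum>k<N. a k N)"
      unfolding a_def sum_distrib_left by (rule sum.swap)
    also have "\<dots> = (\<Sum>k. a k N)"
      by (rule suminf_finite[symmetric]) (auto simp: a_def w_def bailey_kernel_eq_0)
    finally show ?thesis .
  qed
  have lim: "(\<lambda>N. a k N) \<longlonglongrightarrow> ?c * ?R k" for k
  proof -
    have "(\<lambda>N. a k N) \<longlonglongrightarrow> g k * (?c * (qpoch (-1) ?Q k * q ^ (k\<^sup>2 + k) / qpoch (- ?Q) ?Q k))"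
      unfolding a_def w_def using bailey_kernel_sums[OF assms, of k]
      by (intro tendsto_mult tendsto_const) (simp only: sums_def)
    also have "g k * (?c * (qpoch (-1) ?Q k * q ^ (k\<^sup>2 + k) / qpoch (- ?Q) ?Q k)) = ?c * ?R k"
    proof -
      have "q ^ (2 * k\<^sup>2 + k) = q ^ k\<^sup>2 * q ^ (k\<^sup>2 + k)"
        by (simp add: power_add[symmetric] mult_2 add_ac)
      then show ?thesis
        by (simp only: g_def chebyshev_VV_def) (simp add: mult_ac)
    qed
    finally show ?thesis .
  qed
  have bound: "norm (a k N) \<le> M k" for k N
  proof -
    \<comment> \<open>The quadratic exponent is weakened only to fit
      \<open>summable_power_choose_two\<close>.\<close>
    have "k choose 2 \<le> k\<^sup>2"
      using two_choose_two[of k] by linarith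
    then have "norm (q ^ k\<^sup>2) \<le> norm q ^ (k choose 2)"
      using assms unfolding norm_power by (intro power_decreasing) auto
    then show ?thesis
      unfolding a_def M_def g_def norm_mult
      by (intro mult_mono norm_chebyshev_VV_le C mult_nonneg_nonneg) auto
  qed
  have sM: "summable M"
    unfolding M_def using assms by (intro summable_mult2 summable_power_choose_two) auto
  have ev: "\<forall>\<^sub>F (k, N) in sequentially \<times>\<^sub>F sequentially. norm (a k N) \<le> M k"
    by (rule always_eventually) (use bound in auto)
  have tannery: "summable (\<lambda>k. norm (?c * ?R k)) \<and> (\<lambda>N. \<Sum>k. a k N) \<longlonglongrightarrow> (\<Sum>k. ?c * ?R k)"
    by (rule tannerys_theorem[THEN conjunct2, OF lim ev sM]) simp
  \<comment> \<open>Tannery's theorem gives summability of \<open>?c * ?R k\<close>; a nonzero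
    \<open>?c\<close> can be cancelled.\<close>
  have "?c \<noteq> 0"
    using qpoch_inf_nonzero[OF Q(1) mult_power_neq_1[OF Q(1) Q(1)]]
      qpoch_inf_nonzero[OF Q(1) mult_power_neq_1[OF Q]] by simp
  have "summable (\<lambda>k. ?c * ?R k)"
    by (rule summable_norm_cancel[OF conjunct1[OF tannery]])
  then have sR: "summable ?R"
    by (rule summable_mult_D) (rule \<open>?c \<noteq> 0\<close>)
  have "?L sums (\<Sum>k. ?c * ?R k)"
    unfolding sums_def partial by (rule conjunct2[OF tannery])
  also have "(\<Sum>k. ?c * ?R k) = ?c * suminf ?R"
    by (rule suminf_mult[OF sR])
  finally show ?thesis
    using sR by (simp only: sums_iff simp_thms)
qed

end
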